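(* Let $G$ be the group of one of Constructions A–D in the context. (a) In Construction A, $\exp(G)=p$ or $p^2$, and the latter occurs if and only if $p=3$ and $S_1$ is not the zero map. (b) In Constructions B and C, $\exp(G)=p^2$ or $p^3$, and the latter occurs if and only if $p=3$ and the restriction of $S_1$ to $\mathbb{F}_{3^l}$ is not the zero map. (c) In Construction D, $\exp(G)=3^3$ or $3^4$, and the latter occurs if and only if the restriction of $S_1$ to $\mathbb{F}_{3^l}$ is not the zero map.
   Context: Let $q=p^m$, $p$ prime. A pair $(A,\sigma)$, $A\in\mathrm{GL}(4,q)$, $\sigma\in\mathrm{Aut}(\mathbb{F}_q)$, with product $(A_1,\sigma_1)\circ(A_2,\sigma_2)=(A_1^{\sigma_2}A_2,\sigma_1\sigma_2)$ ($A^\sigma$: $\sigma$ applied entrywise). $E(a,b,c,t)$ is the matrix with rows $(1,0,0,0),(-c,1,0,0),(b-ct,t,1,0),(a,b,c,1)$. Given $T$, $\theta$, put $\mathfrak{g}_{a,b,c}=(E(a,b,c,T(a,b,c)),\theta_{a,b,c})$ and $G_{T,\theta}=\{\mathfrak{g}_{a,b,c}\}$. $\mathrm{tr}=\mathrm{tr}_{\mathbb{F}_q/\mathbb{F}_p}$. Construction A: $\theta\equiv1$, $T(a,b,c)=S_1(c)$, $S_1(X)=\sum_{i=0}^{m-1}s_iX^{p^i}$ over $\mathbb{F}_q$; $G=G_{T,\theta}$. Construction B: $q=p^{pl}$, $p$ odd, $g(x)=x^{p^l}$; $S_1$ reduced linearized with coefficients in $\mathbb{F}_{p^l}$; $\mu_C\in\mathbb{F}_{p^l}^*$;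 $\theta_{a,b,c}=g^{\mathrm{tr}(\mu_Cc)}$, $T(a,b,c)=S_1(c)$; $G=G_{T,\theta}$. Construction C: $q=p^{pl}$, $p$ odd, $g(x)=x^{p^l}$; $\mu_B\in\mathbb{F}_{p^l}^*$; $s_i\in\mathbb{F}_{p^l}$ ($0\le i\le pl-1$) with $\mu_Bs_i-s_{pl-i}^{p^i}\mu_B^{p^i}=0$ for $1\le i\le pl-1$; $S_1=\sum s_iX^{p^i}$, $Q(x)=-\mathrm{tr}(\mu_BxS_1(x))$; $\theta_{a,b,c}=g^{\frac12Q(c)+\mathrm{tr}(\mu_Bb)}$, $T(a,b,c)=S_1(c)$; $G=G_{T,\theta}$. Construction D: $q=3^{9l}$, $g(x)=x^{3^l}$, $g_1=g^3$; $u\in\mathbb{F}_{3^{3l}}$ with $\mu_C=u-u^g\in\mathbb{F}_{3^l}^*$; $t_C$ with $\lambda_C=\mathrm{tr}_{\mathbb{F}_q/\mathbb{F}_3}(\mu_Ct_C)\ne0$; $\mu_B\in\mathbb{F}_{3^l}^*$; $s_i\in\mathbb{F}_{3^l}$ with $-\mu_Bs_i+s_{9l-i}^{3^i}\mu_B^{3^i}=\mu_Cu^{3^i}-u\mu_C^{3^i}$, $1\le i\le 9l-1$; $\alpha\in\mathbb{F}_{3^{3l}}$, $\lambda\in\mathbb{F}_3$ with $g(\alpha)-\alpha=\lambda_Cu+\lambda\mu_C$; $S_1=\sum s_iX^{3^i}$, $Q(x)=-\mathrm{tr}_{\mathbb{F}_q/\mathbb{F}_3}(\mu_BxS_1(x))$,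 $K=\{z:\mathrm{tr}_{\mathbb{F}_q/\mathbb{F}_3}(\mu_Cz)=0\}$; for $c\in K$, $\mathfrak{g}_{a,b,c}=(E(a,b,c,S_1(c)),g_1^{\frac12Q(c)+\mathrm{tr}_{\mathbb{F}_q/\mathbb{F}_3}(\alpha c+\mu_Bb)})$; $G=\langle\{\mathfrak{g}_{a,b,c}:c\in K\},(E(0,0,t_C,S_1(t_C)),g)\rangle$.
   Formalization: In (a) the "if and only if" is stated only for odd p: for p = 2 it fails, since a nonzero S_1 (e.g. q = 2, S_1(X) = X) gives exp(G) = 4 = p^2 although p is not 3; "exp(G) = p or p^2" is kept for every prime p. *)

theory Defs
  imports
    "HOL-Analysis.Analysis"
    "HOL-Algebra.Generated_Groups"
    "HOL-Computational_Algebra.Primes"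
begin

text \<open>
  The field with \<open>q\<close> elements is an arbitrary type \<open>'a\<close> of class \<open>finite_field\<close> with
  \<open>CARD('a) = q\<close>. For \<open>q = p ^ m\<close> and \<open>d\<close> dividing \<open>m\<close>, the subfield with \<open>p ^ d\<close> elements is
  \<open>subfld p d\<close>.
\<close>

definition subfld :: "nat \<Rightarrow> nat \<Rightarrow> 'a::finite_field set" where
  "subfld p d = {x. x ^ (p ^ d) = x}"

text \<open>The absolute trace, for \<open>CARD('a) = p ^ m\<close>.\<close>

definition tr :: "nat \<Rightarrow> nat \<Rightarrow> 'a::finite_field \<Rightarrow> 'a" where
  "tr p m x = (\<Sum>i<m. x ^ (p ^ i))"

text \<open>
  Elements of the prime field (such as values of \<open>tr\<close>) occur as exponents of automorphisms of
  order \<open>p\<close>; \<open>rep\<close> picks their representative in \<open>{0..<p}\<close>.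
\<close>

definition rep :: "'a::finite_field \<Rightarrow> nat" where
  "rep z = (LEAST n. of_nat n = z)"

definition lin_poly :: "nat \<Rightarrow> nat \<Rightarrow> (nat \<Rightarrow> 'a::finite_field) \<Rightarrow> 'a \<Rightarrow> 'a" where
  "lin_poly p m s x = (\<Sum>i<m. s i * x ^ (p ^ i))"

definition frob :: "nat \<Rightarrow> nat \<Rightarrow> 'a::finite_field \<Rightarrow> 'a" where
  "frob p l x = x ^ (p ^ l)"

definition field_auts :: "('a::field \<Rightarrow> 'a) set" where
  "field_auts = {\<sigma>. bij \<sigma> \<and> \<sigma> 1 = 1 \<and> (\<forall>x y. \<sigma> (x + y) = \<sigma> x + \<sigma> y) \<and> (\<forall>x y. \<sigma> (x * y) = \<sigma> x * \<sigma> y)}"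

definition map_mat :: "('a \<Rightarrow> 'a) \<Rightarrow> 'a^4^4 \<Rightarrow> 'a^4^4" where
  "map_mat \<sigma> A = (\<chi> i j. \<sigma> (A $ i $ j))"

text \<open>
  Automorphisms act on the right, so the product \<open>\<sigma>\<^sub>1\<sigma>\<^sub>2\<close> is the composition \<open>\<sigma>\<^sub>2 \<circ> \<sigma>\<^sub>1\<close>.
\<close>

definition GammaL4 :: "(('a::finite_field^4^4) \<times> ('a \<Rightarrow> 'a)) monoid" where
  "GammaL4 = \<lparr>carrier = {A. invertible A} \<times> field_auts,
     monoid.mult = (\<lambda>(A\<^sub>1, \<sigma>\<^sub>1) (A\<^sub>2, \<sigma>\<^sub>2). (map_mat \<sigma>\<^sub>2 A\<^sub>1 ** A\<^sub>2, \<sigma>\<^sub>2 \<circ> \<sigma>\<^sub>1)),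
     one = (mat 1, id)\<rparr>"

lemma map_mat_mult:
  assumes "\<sigma> \<in> field_auts"
  shows "map_mat \<sigma> (A ** B) = map_mat \<sigma> A ** map_mat \<sigma> (B :: 'a::field^4^4)"
  using assms by (simp add: field_auts_def map_mat_def matrix_matrix_mult_def vec_eq_iff sum_4)

lemma field_auts_zero: "\<sigma> \<in> field_auts \<Longrightarrow> \<sigma> 0 = 0"
  unfolding field_auts_def by (metis (mono_tags, lifting) add_cancel_right_right mem_Collect_eq)

lemma map_mat_one: "\<sigma> \<in> field_auts \<Longrightarrow> map_mat \<sigma> (mat 1) = mat 1"
  using field_auts_zero[of \<sigma>] by (simp add: field_auts_def map_mat_def mat_def vec_eq_iff)

lemma map_mat_comp: "map_mat \<sigma> (map_mat \<tau> A) = map_mat (\<sigma> \<circ> \<tau>) A"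
  by (simp add: map_mat_def)

lemma map_mat_id: "map_mat id A = A"
  by (simp add: map_mat_def)

lemma map_mat_invertible:
  assumes "\<sigma> \<in> field_auts" "invertible (A :: 'a::field^4^4)"
  shows "invertible (map_mat \<sigma> A)"
  using assms unfolding invertible_def by (metis map_mat_mult map_mat_one)

lemma field_auts_comp: "\<sigma> \<in> field_auts \<Longrightarrow> \<tau> \<in> field_auts \<Longrightarrow> \<sigma> \<circ> \<tau> \<in> field_auts"
  by (auto simp: field_auts_def bij_comp)

lemma field_auts_inv:
  assumes "\<sigma> \<in> field_auts"
  shows "inv_into UNIV \<sigma> \<in> field_auts"
proof -
  have b: "bij \<sigma>" using assms by (simp add: field_auts_def)
  have e: "inv_into UNIV \<sigma> z = w \<longleftrightarrow> z = \<sigma> w" for z w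
    using b by (metis bij_inv_eq_iff)
  have f: "\<sigma> (inv_into UNIV \<sigma> z) = z" for z
    using b by (metis bij_inv_eq_iff)
  show ?thesis
    using assms b by (auto simp: field_auts_def bij_imp_bij_inv e f)
qed

lemma group_GammaL4: "group (GammaL4 :: (('a::finite_field^4^4) \<times> ('a \<Rightarrow> 'a)) monoid)"
proof (rule groupI)
  fix x y :: "('a^4^4) \<times> ('a \<Rightarrow> 'a)"
  assume "x \<in> carrier GammaL4" "y \<in> carrier GammaL4"
  then show "x \<otimes>\<^bsub>GammaL4\<^esub> y \<in> carrier GammaL4"
    by (auto simp: GammaL4_def map_mat_invertible invertible_mult field_auts_comp)
next
  show "\<one>\<^bsub>GammaL4\<^esub> \<in> carrier (GammaL4 :: (('a^4^4) \<times> ('a \<Rightarrow> 'a)) monoid)"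
    by (auto simp: GammaL4_def field_auts_def invertible_def intro!: exI[of _ "mat 1"])
next
  fix x y z :: "('a^4^4) \<times> ('a \<Rightarrow> 'a)"
  assume "x \<in> carrier GammaL4" "y \<in> carrier GammaL4" "z \<in> carrier GammaL4"
  then show "x \<otimes>\<^bsub>GammaL4\<^esub> y \<otimes>\<^bsub>GammaL4\<^esub> z = x \<otimes>\<^bsub>GammaL4\<^esub> (y \<otimes>\<^bsub>GammaL4\<^esub> z)"
    by (auto simp: GammaL4_def map_mat_mult map_mat_comp matrix_mul_assoc comp_assoc)
next
  fix x :: "('a^4^4) \<times> ('a \<Rightarrow> 'a)"
  assume "x \<in> carrier GammaL4"
  then show "\<one>\<^bsub>GammaL4\<^esub> \<otimes>\<^bsub>GammaL4\<^esub> x = x"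
    by (auto simp: GammaL4_def map_mat_one)
next
  fix x :: "('a^4^4) \<times> ('a \<Rightarrow> 'a)"
  assume x: "x \<in> carrier GammaL4"
  obtain A \<sigma> where A: "x = (A, \<sigma>)" by fastforce
  have inv: "invertible A" "\<sigma> \<in> field_auts" using x A by (auto simp: GammaL4_def)
  obtain B where B: "A ** B = mat 1" "B ** A = mat 1"
    using inv by (auto simp: invertible_def)
  let ?\<tau> = "inv_into UNIV \<sigma>"
  have s: "\<sigma> \<circ> ?\<tau> = id"
    using inv by (auto simp: field_auts_def fun_eq_iff bij_is_surj surj_f_inv_f)
  have "invertible B" using B by (auto simp: invertible_def)
  then have "(map_mat ?\<tau> B, ?\<tau>) \<in> carrier GammaL4"
    using inv by (auto simp: GammaL4_def map_mat_invertible field_auts_inv)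
  moreover have "(map_mat ?\<tau> B, ?\<tau>) \<otimes>\<^bsub>GammaL4\<^esub> x = \<one>\<^bsub>GammaL4\<^esub>"
    using B s by (simp add: GammaL4_def A map_mat_comp map_mat_id)
  ultimately show "\<exists>y\<in>carrier GammaL4. y \<otimes>\<^bsub>GammaL4\<^esub> x = \<one>\<^bsub>GammaL4\<^esub>" by blast
qed

definition Emat :: "'a::finite_field \<Rightarrow> 'a \<Rightarrow> 'a \<Rightarrow> 'a \<Rightarrow> 'a^4^4" where
  "Emat a b c t = vector [
     vector [1, 0, 0, 0],
     vector [- c, 1, 0, 0],
     vector [b - c * t, t, 1, 0],
     vector [a, b, c, 1]]"

lemma Emat_nth:
  "Emat a b c t $ 1 $ 1 = 1" "Emat a b c t $ 1 $ 2 = 0" "Emat a b c t $ 1 $ 3 = 0" "Emat a b c t $ 1 $ 4 = 0"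
  "Emat a b c t $ 2 $ 1 = - c" "Emat a b c t $ 2 $ 2 = 1" "Emat a b c t $ 2 $ 3 = 0" "Emat a b c t $ 2 $ 4 = 0"
  "Emat a b c t $ 3 $ 1 = b - c * t" "Emat a b c t $ 3 $ 2 = t" "Emat a b c t $ 3 $ 3 = 1" "Emat a b c t $ 3 $ 4 = 0"
  "Emat a b c t $ 4 $ 1 = a" "Emat a b c t $ 4 $ 2 = b" "Emat a b c t $ 4 $ 3 = c" "Emat a b c t $ 4 $ 4 = 1"
  unfolding Emat_def vector_def by simp_all

lemma Emat_mult:
  "Emat a b c t ** Emat a' b' c' t' =
   Emat (a + a' - b * c' + c * (b' - c' * t')) (b + b' + c * t') (c + c') (t + t')"
  by (simp add: vec_eq_iff forall_4 matrix_matrix_mult_def sum_4 Emat_nth algebra_simps)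

lemma Emat_invertible: "invertible (Emat a b c t)"
proof -
  have one: "Emat 0 0 0 0 = mat 1"
    by (simp add: vec_eq_iff forall_4 mat_def Emat_nth)
  let ?B = "Emat (- a) (c * t - b) (- c) (- t)"
  have "Emat a b c t ** ?B = mat 1" "?B ** Emat a b c t = mat 1"
    by (simp_all add: Emat_mult one[symmetric] algebra_simps)
  then show ?thesis unfolding invertible_def by blast
qed

definition gelt :: "('a::finite_field \<Rightarrow> 'a \<Rightarrow> 'a \<Rightarrow> 'a) \<Rightarrow> ('a \<Rightarrow> 'a \<Rightarrow> 'a \<Rightarrow> 'a \<Rightarrow> 'a) \<Rightarrow>
    'a \<Rightarrow> 'a \<Rightarrow> 'a \<Rightarrow> ('a^4^4) \<times> ('a \<Rightarrow> 'a)" where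
  "gelt T \<theta> a b c = (Emat a b c (T a b c), \<theta> a b c)"

definition Gset :: "('a::finite_field \<Rightarrow> 'a \<Rightarrow> 'a \<Rightarrow> 'a) \<Rightarrow> ('a \<Rightarrow> 'a \<Rightarrow> 'a \<Rightarrow> 'a \<Rightarrow> 'a) \<Rightarrow>
    (('a^4^4) \<times> ('a \<Rightarrow> 'a)) set" where
  "Gset T \<theta> = {gelt T \<theta> a b c | a b c. True}"

definition group_exp :: "('g, 'x) monoid_scheme \<Rightarrow> nat" where
  "group_exp G = (LEAST n. 0 < n \<and> (\<forall>x\<in>carrier G. x [^]\<^bsub>G\<^esub> n = \<one>\<^bsub>G\<^esub>))"

definition group_A :: "nat \<Rightarrow> nat \<Rightarrow> (nat \<Rightarrow> 'a::finite_field) \<Rightarrow> (('a^4^4) \<times> ('a \<Rightarrow> 'a)) monoid" where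
  "group_A p m s = GammaL4\<lparr>carrier := Gset (\<lambda>a b c. lin_poly p m s c) (\<lambda>a b c. id)\<rparr>"

definition params_B :: "nat \<Rightarrow> nat \<Rightarrow> (nat \<Rightarrow> 'a::finite_field) \<Rightarrow> 'a \<Rightarrow> bool" where
  "params_B p l s \<mu>\<^sub>C \<longleftrightarrow> prime p \<and> odd p \<and> CARD('a) = p ^ (p * l) \<and>
     (\<forall>i<p * l. s i \<in> subfld p l) \<and> \<mu>\<^sub>C \<in> subfld p l - {0}"

definition group_B :: "nat \<Rightarrow> nat \<Rightarrow> (nat \<Rightarrow> 'a::finite_field) \<Rightarrow> 'a \<Rightarrow>
    (('a^4^4) \<times> ('a \<Rightarrow> 'a)) monoid" where
  "group_B p l s \<mu>\<^sub>C = GammaL4\<lparr>carrier :=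
     Gset (\<lambda>a b c. lin_poly p (p * l) s c) (\<lambda>a b c. frob p l ^^ rep (tr p (p * l) (\<mu>\<^sub>C * c)))\<rparr>"

definition params_C :: "nat \<Rightarrow> nat \<Rightarrow> (nat \<Rightarrow> 'a::finite_field) \<Rightarrow> 'a \<Rightarrow> bool" where
  "params_C p l s \<mu>\<^sub>B \<longleftrightarrow> prime p \<and> odd p \<and> CARD('a) = p ^ (p * l) \<and>
     (\<forall>i<p * l. s i \<in> subfld p l) \<and> \<mu>\<^sub>B \<in> subfld p l - {0} \<and>
     (\<forall>i\<in>{1..<p * l}. \<mu>\<^sub>B * s i - s (p * l - i) ^ (p ^ i) * \<mu>\<^sub>B ^ (p ^ i) = 0)"

definition Qform :: "nat \<Rightarrow> nat \<Rightarrow> (nat \<Rightarrow> 'a::finite_field) \<Rightarrow> 'a \<Rightarrow> 'a \<Rightarrow> 'a" where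
  "Qform p m s \<mu>\<^sub>B x = - tr p m (\<mu>\<^sub>B * x * lin_poly p m s x)"

definition group_C :: "nat \<Rightarrow> nat \<Rightarrow> (nat \<Rightarrow> 'a::finite_field) \<Rightarrow> 'a \<Rightarrow>
    (('a^4^4) \<times> ('a \<Rightarrow> 'a)) monoid" where
  "group_C p l s \<mu>\<^sub>B = GammaL4\<lparr>carrier :=
     Gset (\<lambda>a b c. lin_poly p (p * l) s c)
       (\<lambda>a b c. frob p l ^^ rep (Qform p (p * l) s \<mu>\<^sub>B c / 2 + tr p (p * l) (\<mu>\<^sub>B * b)))\<rparr>"

definition params_D :: "nat \<Rightarrow> (nat \<Rightarrow> 'a::finite_field) \<Rightarrow> 'a \<Rightarrow> 'a \<Rightarrow> 'a \<Rightarrow> 'a \<Rightarrow> 'a \<Rightarrow> bool" where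
  "params_D l s u t\<^sub>C \<mu>\<^sub>B \<alpha> lam \<longleftrightarrow>
     (let \<mu>\<^sub>C = u - frob 3 l u; lam\<^sub>C = tr 3 (9 * l) (\<mu>\<^sub>C * t\<^sub>C) in
       CARD('a) = 3 ^ (9 * l) \<and> u \<in> subfld 3 (3 * l) \<and> \<mu>\<^sub>C \<in> subfld 3 l - {0} \<and> lam\<^sub>C \<noteq> 0 \<and>
       \<mu>\<^sub>B \<in> subfld 3 l - {0} \<and> (\<forall>i<9 * l. s i \<in> subfld 3 l) \<and>
       (\<forall>i\<in>{1..<9 * l}. - \<mu>\<^sub>B * s i + s (9 * l - i) ^ (3 ^ i) * \<mu>\<^sub>B ^ (3 ^ i) =
          \<mu>\<^sub>C * u ^ (3 ^ i) - u * \<mu>\<^sub>C ^ (3 ^ i)) \<and>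
       \<alpha> \<in> subfld 3 (3 * l) \<and> lam \<in> subfld 3 1 \<and> frob 3 l \<alpha> - \<alpha> = lam\<^sub>C * u + lam * \<mu>\<^sub>C)"

definition group_D :: "nat \<Rightarrow> (nat \<Rightarrow> 'a::finite_field) \<Rightarrow> 'a \<Rightarrow> 'a \<Rightarrow> 'a \<Rightarrow> 'a \<Rightarrow>
    (('a^4^4) \<times> ('a \<Rightarrow> 'a)) monoid" where
  "group_D l s u t\<^sub>C \<mu>\<^sub>B \<alpha> =
     (let \<mu>\<^sub>C = u - frob 3 l u; K = {z. tr 3 (9 * l) (\<mu>\<^sub>C * z) = 0}; S = lin_poly 3 (9 * l) s;
        g = frob 3 l; g\<^sub>1 = g ^^ 3 in
       GammaL4\<lparr>carrier := generate GammaL4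
         ({gelt (\<lambda>a b c. S c)
              (\<lambda>a b c. g\<^sub>1 ^^ rep (Qform 3 (9 * l) s \<mu>\<^sub>B c / 2 + tr 3 (9 * l) (\<alpha> * c + \<mu>\<^sub>B * b)))
              a b c | a b c. c \<in> K}
          \<union> {(Emat 0 0 t\<^sub>C (S t\<^sub>C), g)})\<rparr>)"

end

theory Submission
  imports Defs "HOL-Number_Theory.Residues"
begin

text \<open>
  Every element of the groups has the form \<open>x = (E(a, b, c, S(c)), g\<^sup>k)\<close>, where \<open>S = S\<^sub>1\<close> is
  additive and commutes with the Frobenius map \<open>g\<close> of order \<open>p\<^sup>e\<close>; here \<open>e = 0\<close> in Construction A,
  \<open>e = 1\<close> in B and C, \<open>e = 2\<close> in D. If \<open>g\<^sup>k\<close> generates \<open>\<langle>g\<rangle>\<close>, then \<open>x\<close> to the power \<open>p\<^sup>e\<close> is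
  \<open>(E(a', b', C, S(C)), 1)\<close>, where \<open>C\<close> is the trace of \<open>c\<close> to the fixed field of \<open>g\<close>; otherwise an
  earlier power of \<open>x\<close> already has trivial automorphism part. The \<open>n\<close>-th power of \<open>E(a, b, c, t)\<close>
  has bottom left entry \<open>n a - (n + 1 choose 3) c\<^sup>2 t\<close>, so its \<open>p\<close>-th power (\<open>p\<close> odd) is trivial
  unless \<open>p = 3\<close> and \<open>c\<^sup>2 t \<noteq> 0\<close>. Hence only the values of \<open>S\<close> on the fixed field matter. An
  element of maximal order exists because an affine hyperplane \<open>tr(\<mu> c) = v \<noteq> 0\<close> over the prime
  field consists of entries \<open>c\<close> for which \<open>g\<^sup>k\<close> can be chosen to be a generator, and no nonzero
  additive map, such as the trace or \<open>c \<mapsto> S(C)\<close>, vanishes on it.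
\<close>

section \<open>Additive maps and traces\<close>

lemma additive_of_nat_mult:
  fixes f :: "'a::ring_1 \<Rightarrow> 'b::ring_1"
  assumes "Modules.additive f"
  shows "f (of_nat n * x) = of_nat n * f x"
proof -
  interpret Modules.additive f by (rule assms)
  show ?thesis by (induction n) (simp_all add: zero add distrib_right)
qed

lemma additive_nonzero_common_argument:
  assumes f: "Modules.additive f" "f x \<noteq> 0" and h: "Modules.additive h" "h y \<noteq> 0"
  obtains z where "f z \<noteq> 0" "h z \<noteq> 0"
proof -
  consider "h x \<noteq> 0" | "f y \<noteq> 0" | "h x = 0" "f y = 0" by blast
  then show ?thesis
  proof cases
    case 3
    then have "f (x + y) \<noteq> 0" "h (x + y) \<noteq> 0"
      using f h by (simp_all add: additive.add)
    then show ?thesis by (rule that)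
  qed (use that f h in blast)+
qed

text \<open>If \<open>\<sigma>\<close> has order \<open>n\<close>, this is the trace to the fixed field of \<open>\<sigma>\<close>.\<close>

definition cyclic_trace :: "('a \<Rightarrow> 'a) \<Rightarrow> nat \<Rightarrow> 'a \<Rightarrow> 'a::comm_monoid_add" where
  "cyclic_trace \<sigma> n x = (\<Sum>i<n. (\<sigma> ^^ i) x)"

lemma additive_funpow:
  fixes \<sigma> :: "'a \<Rightarrow> 'a::ab_group_add"
  assumes "Modules.additive \<sigma>"
  shows "Modules.additive (\<sigma> ^^ n)"
  by (induction n) (use assms in \<open>simp_all add: Modules.additive_def\<close>)

lemma additive_cyclic_trace:
  assumes "Modules.additive \<sigma>"
  shows "Modules.additive (cyclic_trace \<sigma> n)"
  using additive.add[OF additive_funpow[OF assms]]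
  by (simp add: Modules.additive_def cyclic_trace_def sum.distrib)

lemma cyclic_trace_Suc: "cyclic_trace \<sigma> (Suc n) x = cyclic_trace \<sigma> n (\<sigma> x) + x"
  unfolding cyclic_trace_def
  by (subst sum.lessThan_Suc_shift) (simp add: funpow_swap1 add.commute)

lemma additive_apply_cyclic_trace:
  assumes "Modules.additive \<sigma>"
  shows "\<sigma> (cyclic_trace \<sigma> n x) = cyclic_trace \<sigma> n (\<sigma> x)"
  by (simp add: cyclic_trace_def additive.sum[OF assms] funpow_swap1)

lemma cyclic_trace_apply:
  fixes x :: "'a::ab_group_add"
  assumes "\<sigma> ^^ n = id"
  shows "cyclic_trace \<sigma> n (\<sigma> x) = cyclic_trace \<sigma> n x"
  using cyclic_trace_Suc[of \<sigma> n x] assms by (simp add: cyclic_trace_def)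

lemma cyclic_trace_apply_funpow:
  fixes x :: "'a::ab_group_add"
  assumes "\<sigma> ^^ n = id"
  shows "cyclic_trace \<sigma> n ((\<sigma> ^^ k) x) = cyclic_trace \<sigma> n x"
  by (induction k) (simp_all add: cyclic_trace_apply[OF assms])

lemma cyclic_trace_fixed:
  assumes "Modules.additive \<sigma>" "\<sigma> ^^ n = id"
  shows "\<sigma> (cyclic_trace \<sigma> n x) = cyclic_trace \<sigma> n x"
  using assms by (simp add: additive_apply_cyclic_trace cyclic_trace_apply)

lemma cyclic_trace_transitive:
  assumes "Modules.additive \<sigma>"
  shows "cyclic_trace \<sigma> l (cyclic_trace (\<sigma> ^^ l) n x) = cyclic_trace \<sigma> (n * l) x"
proof -
  have "cyclic_trace \<sigma> l (cyclic_trace (\<sigma> ^^ l) n x) = (\<Sum>i<l. \<Sum>j<n. (\<sigma> ^^ (i + j * l)) x)"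
    by (simp add: cyclic_trace_def additive.sum[OF additive_funpow[OF assms]] funpow_mult funpow_add
        mult.commute)
  also have "\<dots> = (\<Sum>j<n. \<Sum>i<l. (\<sigma> ^^ (i + j * l)) x)"
    by (rule sum.swap)
  also have "\<dots> = (\<Sum>j<n. \<Sum>i\<in>{j * l..<j * l + l}. (\<sigma> ^^ i) x)"
    by (simp add: sum.atLeastLessThan_shift_0[of _ "_ * l"] lessThan_atLeast0 add.commute)
  also have "\<dots> = cyclic_trace \<sigma> (n * l) x"
    by (simp add: cyclic_trace_def sum.nat_group)
  finally show ?thesis .
qed

lemma cyclic_trace_funpow_coprime:
  assumes "\<sigma> ^^ n = id" "coprime k n"
  shows "cyclic_trace (\<sigma> ^^ k) n x = cyclic_trace \<sigma> n x"
proof -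
  have "inj_on (\<lambda>i. k * i mod n) {..<n}"
    using cong_mult_lcancel_nat[OF assms(2)] by (auto simp: inj_on_def cong_def)
  then have bij: "bij_betw (\<lambda>i. k * i mod n) {..<n} {..<n}"
    unfolding bij_betw_def by (intro conjI endo_inj_surj) auto
  have "((\<sigma> ^^ k) ^^ i) x = (\<sigma> ^^ (k * i mod n)) x" for i
    using funpow_mod_eq[of n \<sigma> x "k * i"] assms(1) by (simp add: funpow_mult mult.commute)
  then show ?thesis
    using sum.reindex_bij_betw[OF bij, of "\<lambda>i. (\<sigma> ^^ i) x"] by (simp add: cyclic_trace_def)
qed

section \<open>Finite fields\<close>

lemma CHAR_eq_of_CARD:
  assumes "prime p" "CARD('a::finite_field) = p ^ m"
  shows "CHAR('a) = p"
proof -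
  have "CHAR('a) dvd p ^ m" using CHAR_dvd_CARD[where ?'a = 'a] assms(2) by simp
  then show ?thesis using assms(1) CHAR_prime by (meson prime_dvd_power primes_dvd_imp_eq)
qed

lemma field_auts_additive: "\<sigma> \<in> field_auts \<Longrightarrow> Modules.additive \<sigma>"
  by (simp add: field_auts_def Modules.additive_def)

lemma id_field_auts: "id \<in> field_auts"
  by (simp add: field_auts_def)

lemma field_auts_funpow:
  assumes "\<sigma> \<in> field_auts"
  shows "\<sigma> ^^ n \<in> field_auts"
  by (induction n) (unfold funpow.simps, rule id_field_auts, rule field_auts_comp[OF assms])

lemma power_char_power_add:
  assumes "CHAR('a::finite_field) = p"
  shows "(x + y :: 'a) ^ (p ^ i) = x ^ (p ^ i) + y ^ (p ^ i)"
  by (rule freshmans_dream') (simp_all add: assms[symmetric])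

lemma frob_field_auts:
  assumes "CHAR('a::finite_field) = p"
  shows "frob p l \<in> (field_auts :: ('a \<Rightarrow> 'a) set)"
proof -
  interpret Modules.additive "frob p l :: 'a \<Rightarrow> 'a"
    by (simp add: Modules.additive_def frob_def power_char_power_add[OF assms])
  have "inj (frob p l :: 'a \<Rightarrow> 'a)"
  proof (rule injI)
    fix x y :: 'a
    assume "frob p l x = frob p l y"
    then have "frob p l (x - y) = 0" by (simp add: diff)
    then show "x = y" by (simp add: frob_def)
  qed
  then have "bij (frob p l :: 'a \<Rightarrow> 'a)"
    by (simp add: bijI finite_UNIV_inj_surj)
  then show ?thesis
    by (simp add: field_auts_def add) (simp add: frob_def power_mult_distrib)
qed

lemmas additive_frob = field_auts_additive[OF frob_field_auts]

lemma frob_funpow: "(frob p l ^^ k) = frob p (l * k)"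
proof (induction k)
  case (Suc k)
  then show ?case
    by (simp add: fun_eq_iff frob_def power_mult[symmetric] power_add mult.commute)
qed (simp add: fun_eq_iff frob_def)

lemma frob_CARD:
  assumes "CARD('a::finite_field) = p ^ m"
  shows "frob p m = (id :: 'a \<Rightarrow> 'a)"
  using finite_field_power_card_eq_same[where ?'a = 'a] assms by (simp add: fun_eq_iff frob_def)

lemma mem_subfld_iff: "x \<in> subfld p l \<longleftrightarrow> frob p l x = x"
  by (simp add: subfld_def frob_def)

lemma additive_lin_poly:
  assumes "CHAR('a::finite_field) = p"
  shows "Modules.additive (lin_poly p m s :: 'a \<Rightarrow> 'a)"
  by (simp add: Modules.additive_def lin_poly_def power_char_power_add[OF assms] distrib_left sum.distrib)

lemma lin_poly_frob:
  assumes "CHAR('a::finite_field) = p" "\<forall>i<m. s i \<in> (subfld p l :: 'a set)"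
  shows "lin_poly p m s (frob p l x) = frob p l (lin_poly p m s x)"
proof -
  have "frob p l (s i * x ^ (p ^ i)) = s i * frob p l x ^ (p ^ i)" if "i < m" for i
    using assms(2) that
    by (simp add: subfld_def frob_def power_mult_distrib power_mult[symmetric] mult.commute)
  then show ?thesis
    by (simp add: lin_poly_def additive.sum[OF additive_frob[OF assms(1)]])
qed

lemma lin_poly_nonzero:
  assumes "1 < p" "CARD('a::finite_field) = p ^ m" "i < m" "s i \<noteq> (0 :: 'a)"
  shows "\<exists>x. lin_poly p m s x \<noteq> 0"
proof (rule ccontr)
  assume vanishes: "\<not> ?thesis"
  define P where "P = (\<Sum>j<m. Polynomial.monom (s j) (p ^ j))"
  have "poly P x = lin_poly p m s x" for x
    by (simp add: P_def lin_poly_def poly_sum poly_monom)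
  then have roots: "{x. poly P x = 0} = UNIV" using vanishes by simp
  have "poly.coeff P (p ^ i) = s i"
    using assms(1,3) by (simp add: P_def coeff_sum sum.delta)
  then have "P \<noteq> 0" using assms(4) by auto
  have "Polynomial.degree P \<le> p ^ (m - 1)"
    unfolding P_def using assms(1)
    by (intro degree_sum_le) (auto intro!: order.trans[OF Polynomial.degree_monom_le] power_increasing)
  also have "\<dots> < CARD('a)"
    using assms(1-3) by (auto intro!: power_strict_increasing)
  finally show False
    using card_poly_roots_bound[OF \<open>P \<noteq> 0\<close>] roots by simp
qed

lemma tr_eq_cyclic_trace: "tr p m = cyclic_trace (frob p 1) m"
  by (simp add: fun_eq_iff tr_def cyclic_trace_def frob_funpow frob_def)

lemma additive_tr:
  assumes "CHAR('a::finite_field) = p"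
  shows "Modules.additive (tr p m :: 'a \<Rightarrow> 'a)"
  unfolding tr_eq_cyclic_trace by (rule additive_cyclic_trace[OF additive_frob[OF assms]])

lemma tr_power_char:
  assumes "CHAR('a::finite_field) = p" "CARD('a) = p ^ m"
  shows "tr p m (x :: 'a) ^ p = tr p m x"
proof -
  have "frob p 1 (tr p m x) = tr p m x"
    unfolding tr_eq_cyclic_trace
    by (rule cyclic_trace_fixed[OF additive_frob[OF assms(1)]])
      (simp add: frob_funpow frob_CARD[OF assms(2)])
  then show ?thesis by (simp add: frob_def)
qed

lemma tr_frob:
  assumes "CARD('a::finite_field) = p ^ m"
  shows "tr p m (frob p l x) = tr p m (x :: 'a)"
  using cyclic_trace_apply_funpow[where \<sigma> = "frob p 1" and n = m and k = l and x = x] frob_CARD[OF assms]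
  by (simp add: tr_eq_cyclic_trace frob_funpow)

lemma tr_nonzero:
  assumes "prime p" "CARD('a::finite_field) = p ^ m"
  shows "\<exists>x :: 'a. tr p m x \<noteq> 0"
proof -
  have "CARD('a) \<noteq> 1"
    by (metis UNIV_I card_1_singletonE singletonD zero_neq_one)
  then have "0 < m" using assms(2) by (cases m) auto
  then show ?thesis
    using lin_poly_nonzero[of p m 0 "\<lambda>_. 1 :: 'a"] prime_gt_1_nat[OF assms(1)] assms(2)
    by (simp add: lin_poly_def tr_def)
qed

lemma cyclic_trace_frob_nonzero:
  assumes "prime p" "CARD('a::finite_field) = p ^ (n * l)"
  shows "\<exists>x :: 'a. cyclic_trace (frob p l) n x \<noteq> 0"
proof -
  have char: "CHAR('a) = p" by (rule CHAR_eq_of_CARD[OF assms])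
  obtain x :: 'a where "tr p (n * l) x \<noteq> 0" using tr_nonzero[OF assms] by blast
  then have "tr p l (cyclic_trace (frob p l) n x) \<noteq> 0"
    using cyclic_trace_transitive[OF additive_frob[OF char, of 1], where l = l and n = n and x = x]
    by (simp add: tr_eq_cyclic_trace frob_funpow)
  then show ?thesis using additive.zero[OF additive_tr[OF char]] by metis
qed

lemma cyclic_trace_frob_onto_subfld:
  assumes "prime p" "CARD('a::finite_field) = p ^ (n * l)" "y \<in> (subfld p l :: 'a set)"
  shows "\<exists>x. cyclic_trace (frob p l) n x = y"
proof -
  have char: "CHAR('a) = p" by (rule CHAR_eq_of_CARD[OF assms(1,2)])
  obtain x :: 'a where x: "cyclic_trace (frob p l) n x \<noteq> 0"
    using cyclic_trace_frob_nonzero[OF assms(1,2)] by blast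
  define r where "r = y / cyclic_trace (frob p l) n x"
  have "frob p l (cyclic_trace (frob p l) n x) = cyclic_trace (frob p l) n x"
    using assms(2)
    by (intro cyclic_trace_fixed additive_frob[OF char]) (simp add: frob_funpow mult.commute frob_CARD)
  then have "r \<in> subfld p l"
    using assms(3) by (simp add: r_def mem_subfld_iff) (simp add: frob_def power_divide)
  then have "(frob p l ^^ i) (r * x) = r * (frob p l ^^ i) x" for i
    by (induction i) (simp_all add: subfld_def frob_def power_mult_distrib)
  then have "cyclic_trace (frob p l) n (r * x) = r * cyclic_trace (frob p l) n x"
    by (simp add: cyclic_trace_def sum_distrib_left)
  with x show ?thesis by (auto simp: r_def)
qed

lemma roots_power_char_eq:
  assumes "CHAR('a::finite_field) = p"
  shows "{x :: 'a. x ^ p = x} = of_nat ` {..<p}"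
proof -
  have "p > 1" using assms CHAR_prime[where ?'a = 'a] prime_gt_1_nat by blast
  have "(of_nat n :: 'a) ^ p = of_nat n" for n
    using \<open>p > 1\<close> power_char_power_add[OF assms, of 1 _ 1] by (induction n) auto
  then have subset: "of_nat ` {..<p} \<subseteq> {x :: 'a. x ^ p = x}" by auto
  define P where "P = Polynomial.monom 1 p - Polynomial.monom (1 :: 'a) 1"
  have "poly.coeff P p = 1" using \<open>p > 1\<close> by (simp add: P_def)
  then have "P \<noteq> 0" by auto
  have "{x. x ^ p = x} = {x. poly P x = 0}" by (simp add: P_def poly_monom)
  then have "card {x :: 'a. x ^ p = x} \<le> Polynomial.degree P"
    using card_poly_roots_bound[OF \<open>P \<noteq> 0\<close>] by simp
  also have "\<dots> \<le> p"
    unfolding P_def using \<open>p > 1\<close>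
    by (intro Polynomial.degree_diff_le) (auto simp: Polynomial.degree_monom_eq)
  also have "p = card (of_nat ` {..<p} :: 'a set)"
    using assms by (subst card_image) (auto simp: inj_on_def of_nat_eq_iff_cong_CHAR cong_def)
  finally show ?thesis
    using card_seteq[OF _ subset] by auto
qed

lemma of_nat_rep:
  assumes "CHAR('a::finite_field) = p" "(z :: 'a) ^ p = z"
  shows "of_nat (rep z) = z"
proof -
  have "z \<in> of_nat ` {..<p}"
    using assms(2) by (simp flip: roots_power_char_eq[OF assms(1)])
  then obtain n where "of_nat n = z" by auto
  then show ?thesis unfolding rep_def by (rule LeastI)
qed

lemma coprime_rep:
  assumes "CHAR('a::finite_field) = p" "(z :: 'a) ^ p = z" "z \<noteq> 0"
  shows "coprime (rep z) p"
proof -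
  have "\<not> p dvd rep z"
    using of_nat_rep[OF assms(1,2)] assms(1,3) of_nat_eq_0_iff_char_dvd by metis
  then show ?thesis
    using assms(1) CHAR_prime[where ?'a = 'a] prime_imp_coprime coprime_commute by blast
qed

lemma tr_mult_nonzero:
  assumes "prime p" "CARD('a::finite_field) = p ^ m" "\<mu> \<noteq> (0::'a)"
  shows "\<exists>x. tr p m (\<mu> * x) \<noteq> 0"
proof -
  obtain x :: 'a where "tr p m x \<noteq> 0" using tr_nonzero[OF assms(1,2)] by blast
  then have "tr p m (\<mu> * (x / \<mu>)) \<noteq> 0" using assms(3) by simp
  then show ?thesis ..
qed

definition trace_hyperplane :: "nat \<Rightarrow> nat \<Rightarrow> 'a::finite_field \<Rightarrow> 'a \<Rightarrow> 'a set" where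
  "trace_hyperplane p m \<mu> v = {c. tr p m (\<mu> * c) = v}"

lemma additive_nonzero_on_trace_hyperplane:
  assumes "prime p" "CARD('a::finite_field) = p ^ m" "\<mu> \<noteq> (0::'a)" "v \<noteq> 0" "v ^ p = v"
    and h: "Modules.additive h" "h (y :: 'a) \<noteq> (0 :: 'a)"
  obtains c where "c \<in> trace_hyperplane p m \<mu> v" "h c \<noteq> 0"
proof -
  have char: "CHAR('a) = p" by (rule CHAR_eq_of_CARD[OF assms(1,2)])
  let ?f = "\<lambda>c. tr p m (\<mu> * c)"
  have f: "Modules.additive ?f"
    using additive.add[OF additive_tr[OF char]] by (simp add: Modules.additive_def distrib_left)
  obtain z where z: "?f z \<noteq> 0" "h z \<noteq> 0"
    using additive_nonzero_common_argument[OF f _ h] tr_mult_nonzero[OF assms(1-3)] by blast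
  define n where "n = rep (v / ?f z)"
  have n: "of_nat n = v / ?f z"
    unfolding n_def
    by (rule of_nat_rep[OF char]) (simp add: power_divide assms(5) tr_power_char[OF char assms(2)])
  show ?thesis
  proof
    have "?f (of_nat n * z) = v"
      unfolding additive_of_nat_mult[OF f] using z by (simp add: n)
    then show "of_nat n * z \<in> trace_hyperplane p m \<mu> v" by (simp add: trace_hyperplane_def)
    show "h (of_nat n * z) \<noteq> 0"
      unfolding additive_of_nat_mult[OF h(1)] using z assms(4) by (simp add: n)
  qed
qed

section \<open>Powers in the semilinear group\<close>

interpretation GL4: group GammaL4
  by (rule group_GammaL4)

lemma map_mat_Emat:
  assumes "\<sigma> \<in> field_auts"
  shows "map_mat \<sigma> (Emat a b c t) = Emat (\<sigma> a) (\<sigma> b) (\<sigma> c) (\<sigma> t)"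
proof -
  interpret Modules.additive \<sigma> by (rule field_auts_additive[OF assms])
  have "\<sigma> (x * y) = \<sigma> x * \<sigma> y" "\<sigma> 1 = 1" for x y
    using assms by (auto simp: field_auts_def)
  then show ?thesis
    by (simp add: vec_eq_iff forall_4 map_mat_def Emat_nth zero minus diff)
qed

lemma Emat_zero: "Emat 0 0 0 0 = mat 1"
  by (simp add: vec_eq_iff forall_4 mat_def Emat_nth)

lemma GammaL4_one: "\<one>\<^bsub>GammaL4\<^esub> = (Emat 0 0 0 0, id)"
  by (simp add: GammaL4_def Emat_zero)

lemma Emat_eq_iff: "Emat a b c t = Emat a' b' c' t' \<longleftrightarrow> a = a' \<and> b = b' \<and> c = c' \<and> t = t'"
  by (auto simp: vec_eq_iff forall_4 Emat_nth)

lemma Emat_in_GammaL4: "\<sigma> \<in> field_auts \<Longrightarrow> (Emat a b c t, \<sigma>) \<in> carrier GammaL4"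
  by (simp add: GammaL4_def Emat_invertible)

lemma GammaL4_mult_Emat:
  assumes "\<tau> \<in> field_auts"
  shows "(Emat a b c t, \<sigma>) \<otimes>\<^bsub>GammaL4\<^esub> (Emat a' b' c' t', \<tau>) =
    (Emat (\<tau> a + a' - \<tau> b * c' + \<tau> c * (b' - c' * t')) (\<tau> b + b' + \<tau> c * t') (\<tau> c + c') (\<tau> t + t'), \<tau> \<circ> \<sigma>)"
  by (simp add: GammaL4_def map_mat_Emat[OF assms] Emat_mult)

lemma Emat_semilinear_pow:
  assumes "\<sigma> \<in> field_auts" "Modules.additive S" "\<And>x. S (\<sigma> x) = \<sigma> (S x)"
  shows "\<exists>a' b'. (Emat a b c (S c), \<sigma>) [^]\<^bsub>GammaL4\<^esub> (n::nat) =
    (Emat a' b' (cyclic_trace \<sigma> n c) (S (cyclic_trace \<sigma> n c)), \<sigma> ^^ n)"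
proof (induction n)
  case 0
  show ?case
    using additive.zero[OF assms(2)] by (auto simp: GammaL4_one cyclic_trace_def)
next
  case (Suc n)
  then obtain a' b' where IH: "(Emat a b c (S c), \<sigma>) [^]\<^bsub>GammaL4\<^esub> n =
    (Emat a' b' (cyclic_trace \<sigma> n c) (S (cyclic_trace \<sigma> n c)), \<sigma> ^^ n)" by blast
  show ?case
    unfolding cyclic_trace_Suc additive_apply_cyclic_trace[OF field_auts_additive[OF assms(1)], symmetric]
    by (auto simp: IH GammaL4_mult_Emat[OF assms(1)] additive.add[OF assms(2)] assms(3))
qed

lemma Emat_linear_pow:
  "(Emat a b c t, id) [^]\<^bsub>GammaL4\<^esub> (n::nat) =
    (Emat (of_nat n * a - of_nat (Suc n choose 3) * (c\<^sup>2 * t))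
      (of_nat n * b + of_nat (n choose 2) * (c * t))
      (of_nat n * c) (of_nat n * t), id)"
proof (induction n)
  case 0
  show ?case by (simp add: GammaL4_one numeral_3_eq_3 numeral_2_eq_2 id_def)
next
  case (Suc n)
  have choose_3: "Suc (Suc n) choose 3 = n + (n choose 2) + (Suc n choose 3)"
    and choose_2: "Suc n choose 2 = n + (n choose 2)"
    by (simp_all add: numeral_3_eq_3 numeral_2_eq_2)
  show ?case
    unfolding GL4.nat_pow_Suc Suc.IH GammaL4_mult_Emat[OF id_field_auts] choose_3 choose_2
    by (simp add: algebra_simps power2_eq_square id_def comp_def)
qed

lemma Emat_linear_pow_char_sq:
  assumes "CHAR('a::finite_field) = p"
  shows "(Emat a b c (t :: 'a), id) [^]\<^bsub>GammaL4\<^esub> (p ^ 2) = \<one>\<^bsub>GammaL4\<^esub>"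
proof -
  have "of_nat p = (0 :: 'a)" using assms of_nat_CHAR by blast
  then have pow_zero: "(Emat a' b' 0 (0 :: 'a), id) [^]\<^bsub>GammaL4\<^esub> p = \<one>\<^bsub>GammaL4\<^esub>"
    and pow_p: "\<exists>a' b'. (Emat a b c t, id) [^]\<^bsub>GammaL4\<^esub> p = (Emat a' b' 0 0, id)" for a' b'
    by (auto simp: Emat_linear_pow GammaL4_one)
  have "(Emat a b c t, id) [^]\<^bsub>GammaL4\<^esub> (p ^ 2) = ((Emat a b c t, id) [^]\<^bsub>GammaL4\<^esub> p) [^]\<^bsub>GammaL4\<^esub> p"
    by (simp add: GL4.nat_pow_pow Emat_in_GammaL4 id_field_auts power2_eq_square)
  then show ?thesis using pow_p pow_zero by metis
qed

lemma odd_prime_dvd_choose_2: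
  fixes p :: nat
  assumes "prime p" "odd p"
  shows "p dvd (p choose 2)"
proof -
  have "2 < p" using assms prime_gt_1_nat[of p] by (cases "p = 2") auto
  then show ?thesis using assms(1) by (simp add: dvd_choose_prime)
qed

lemma odd_prime_dvd_Suc_choose_3_iff:
  fixes p :: nat
  assumes "prime p" "odd p"
  shows "p dvd (Suc p choose 3) \<longleftrightarrow> p \<noteq> 3"
proof -
  have "2 < p" using assms prime_gt_1_nat[of p] by (cases "p = 2") auto
  then have "p dvd (p choose 3)" if "p \<noteq> 3"
    using that assms(1) by (simp add: dvd_choose_prime)
  moreover have "Suc p choose 3 = (p choose 2) + (p choose 3)"
    by (simp add: numeral_3_eq_3 numeral_2_eq_2)
  ultimately show ?thesis
    using odd_prime_dvd_choose_2[OF assms] by (auto simp: dvd_add_right_iff)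
qed

lemma Emat_linear_pow_char_eq_one_iff:
  assumes "CHAR('a::finite_field) = p" "odd p"
  shows "(Emat a b c (t :: 'a), id) [^]\<^bsub>GammaL4\<^esub> p = \<one>\<^bsub>GammaL4\<^esub> \<longleftrightarrow> p \<noteq> 3 \<or> c = 0 \<or> t = 0"
proof -
  have "prime p" using assms(1) CHAR_prime[where ?'a = 'a] by simp
  then have "of_nat (p choose 2) = (0 :: 'a)" "of_nat (Suc p choose 3) = (0 :: 'a) \<longleftrightarrow> p \<noteq> 3"
    unfolding of_nat_eq_0_iff_char_dvd assms(1)
    using odd_prime_dvd_choose_2 odd_prime_dvd_Suc_choose_3_iff assms(2) by blast+
  moreover have "of_nat p = (0 :: 'a)" using assms(1) of_nat_CHAR by blast
  ultimately show ?thesis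
    by (auto simp: Emat_linear_pow GammaL4_one Emat_eq_iff simp del: binomial_Suc_Suc)
qed

section \<open>Exponents\<close>

lemma (in group) subgroup_of_finite_closed:
  assumes "finite H" "H \<subseteq> carrier G" "H \<noteq> {}" and closed: "\<And>x y. x \<in> H \<Longrightarrow> y \<in> H \<Longrightarrow> x \<otimes> y \<in> H"
  shows "subgroup H G"
proof (rule subgroupI)
  fix x assume "x \<in> H"
  then have "x \<in> carrier G" using assms(2) by blast
  have "(\<otimes>) x ` H = H"
    using \<open>x \<in> H\<close> inj_on_subset[OF inj_on_cmult[OF \<open>x \<in> carrier G\<close>] assms(2)]
    by (intro endo_inj_surj assms(1)) (auto intro: closed)
  then have solve: "\<exists>z\<in>H. x \<otimes> z = y" if "y \<in> H" for y
    using that by (metis imageE)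
  then obtain y where "y \<in> H" "x \<otimes> y = x" using \<open>x \<in> H\<close> by blast
  then have "\<one> \<in> H" using \<open>x \<in> carrier G\<close> assms(2) by auto
  then obtain z where "z \<in> H" "x \<otimes> z = \<one>" using solve by blast
  moreover from this have "inv x = z"
    using \<open>x \<in> carrier G\<close> assms(2) inv_comm by (intro inv_equality) auto
  ultimately show "inv x \<in> H" by simp
qed (use assms(2,3) closed in auto)

lemma (in group) group_exp_eq_prime_power:
  assumes "prime p" "X \<subseteq> carrier G" "\<forall>x\<in>X. x [^] (p ^ Suc k :: nat) = \<one>"
    and y: "y \<in> X" "y [^] (p ^ k) \<noteq> \<one>"
  shows "group_exp (G\<lparr>carrier := X\<rparr>) = p ^ Suc k"
proof -
  have "y \<in> carrier G" using assms(2) y by auto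
  have "ord y dvd p ^ Suc k" "\<not> ord y dvd p ^ k"
    using assms(3) y \<open>y \<in> carrier G\<close> pow_eq_id by blast+
  then obtain j where "j \<le> Suc k" "ord y = p ^ j" "\<not> p ^ j dvd p ^ k"
    using divides_primepow_nat[OF assms(1)] by metis
  then have ord: "ord y = p ^ Suc k"
    using le_imp_power_dvd[of j k p] by (metis le_SucE)
  show ?thesis
    unfolding group_exp_def nat_pow_consistent[symmetric]
  proof (rule Least_equality)
    show "0 < p ^ Suc k \<and> (\<forall>x\<in>carrier (G\<lparr>carrier := X\<rparr>). x [^] (p ^ Suc k) = \<one>\<^bsub>G\<lparr>carrier := X\<rparr>\<^esub>)"
      using assms(3) prime_gt_0_nat[OF assms(1)] by simp
  next
    fix n :: nat
    assume n: "0 < n \<and> (\<forall>x\<in>carrier (G\<lparr>carrier := X\<rparr>). x [^] n = \<one>\<^bsub>G\<lparr>carrier := X\<rparr>\<^esub>)"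
    then have "ord y dvd n" using y(1) \<open>y \<in> carrier G\<close> by (auto simp: pow_eq_id)
    then show "p ^ Suc k \<le> n" using n ord by (simp add: dvd_imp_le)
  qed
qed

lemma (in group) group_exp_dichotomy:
  assumes "prime p" "X \<subseteq> carrier G" "\<forall>x\<in>X. x [^] (p ^ (k + 2) :: nat) = \<one>"
    and "\<exists>y\<in>X. y [^] (p ^ k) \<noteq> \<one>"
  shows "group_exp (G\<lparr>carrier := X\<rparr>) \<in> {p ^ (k + 1), p ^ (k + 2)}"
    and "group_exp (G\<lparr>carrier := X\<rparr>) = p ^ (k + 2) \<longleftrightarrow> (\<exists>x\<in>X. x [^] (p ^ (k + 1)) \<noteq> \<one>)"
proof -
  have "group_exp (G\<lparr>carrier := X\<rparr>) = p ^ (if \<exists>x\<in>X. x [^] (p ^ (k + 1)) \<noteq> \<one> then k + 2 else k + 1)"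
    using group_exp_eq_prime_power[OF assms(1,2), of "k + 1"]
      group_exp_eq_prime_power[OF assms(1,2), of k] assms(3,4)
    by (auto simp del: power_Suc)
  then show "group_exp (G\<lparr>carrier := X\<rparr>) \<in> {p ^ (k + 1), p ^ (k + 2)}"
    and "group_exp (G\<lparr>carrier := X\<rparr>) = p ^ (k + 2) \<longleftrightarrow> (\<exists>x\<in>X. x [^] (p ^ (k + 1)) \<noteq> \<one>)"
    using power_inject_exp[OF prime_gt_1_nat[OF assms(1)]] by (auto simp del: power_Suc)
qed

section \<open>Groups twisted by a Frobenius map\<close>

locale twisted_group = Modules.additive S
  for S :: "'a::finite_field \<Rightarrow> 'a" +
  fixes p e l :: nat
  assumes prime_p: "prime p" and card_field: "CARD('a) = p ^ (p ^ e * l)"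
    and S_frob: "S (frob p l x) = frob p l (S x)"
begin

abbreviation twisted_elem :: "'a \<Rightarrow> 'a \<Rightarrow> 'a \<Rightarrow> nat \<Rightarrow> ('a^4^4) \<times> ('a \<Rightarrow> 'a)" where
  "twisted_elem a b c k \<equiv> (Emat a b c (S c), frob p l ^^ k)"

definition twisted :: "(('a^4^4) \<times> ('a \<Rightarrow> 'a)) set" where
  "twisted = {twisted_elem a b c k | a b c k. True}"

definition field_trace :: "'a \<Rightarrow> 'a" where
  "field_trace = cyclic_trace (frob p l) (p ^ e)"

definition generic_entries :: "(('a^4^4) \<times> ('a \<Rightarrow> 'a)) set \<Rightarrow> 'a set" where
  "generic_entries X = {c. \<exists>a b k. twisted_elem a b c k \<in> X \<and> coprime k (p ^ e)}"

lemma char_field: "CHAR('a) = p"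
  by (rule CHAR_eq_of_CARD[OF prime_p card_field])

lemma frob_funpow_aut: "frob p l ^^ k \<in> (field_auts :: ('a \<Rightarrow> 'a) set)"
  by (rule field_auts_funpow[OF frob_field_auts[OF char_field]])

lemma frob_period: "frob p l ^^ (p ^ e) = (id :: 'a \<Rightarrow> 'a)"
  using frob_CARD[OF card_field] by (simp add: frob_funpow mult.commute)

lemma frob_period_dvd:
  assumes "p ^ e dvd k"
  shows "frob p l ^^ k = (id :: 'a \<Rightarrow> 'a)"
proof -
  obtain j where "k = p ^ e * j" using assms by blast
  then have "frob p l ^^ k = (frob p l ^^ (p ^ e) :: 'a \<Rightarrow> 'a) ^^ j" by (simp add: funpow_mult)
  then show ?thesis unfolding frob_period id_funpow .
qed

lemma S_frob_funpow: "S ((frob p l ^^ k) x) = (frob p l ^^ k) (S x)"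
  by (induction k) (simp_all add: S_frob)

lemma additive_field_trace: "Modules.additive field_trace"
  unfolding field_trace_def by (rule additive_cyclic_trace[OF additive_frob[OF char_field]])

lemma field_trace_in_subfld: "field_trace c \<in> subfld p l"
  unfolding mem_subfld_iff field_trace_def
  by (rule cyclic_trace_fixed[OF additive_frob[OF char_field] frob_period])

lemma field_trace_onto_subfld: "y \<in> subfld p l \<Longrightarrow> \<exists>c. field_trace c = y"
  unfolding field_trace_def by (rule cyclic_trace_frob_onto_subfld[OF prime_p card_field])

lemma field_trace_nonzero: "\<exists>c. field_trace c \<noteq> 0"
  unfolding field_trace_def by (rule cyclic_trace_frob_nonzero[OF prime_p card_field])

lemma twisted_subset_carrier: "twisted \<subseteq> carrier GammaL4"
  by (auto simp: twisted_def Emat_in_GammaL4 frob_funpow_aut)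

lemma twisted_mult_closed:
  assumes "x \<in> twisted" "y \<in> twisted"
  shows "x \<otimes>\<^bsub>GammaL4\<^esub> y \<in> twisted"
proof -
  obtain a b c k where x: "x = twisted_elem a b c k"
    using assms(1) by (auto simp: twisted_def)
  obtain a' b' c' k' where y: "y = twisted_elem a' b' c' k'"
    using assms(2) by (auto simp: twisted_def)
  show ?thesis
    unfolding x y GammaL4_mult_Emat[OF frob_funpow_aut] S_frob_funpow[symmetric] add[symmetric]
      funpow_add[symmetric] twisted_def
    by blast
qed

lemma subgroup_twisted: "subgroup twisted GammaL4"
proof (rule GL4.subgroup_of_finite_closed)
  show "twisted \<noteq> {}" by (auto simp: twisted_def)
qed (simp_all add: twisted_subset_carrier twisted_mult_closed)

lemma twisted_pow:
  "\<exists>a' b'. twisted_elem a b c k [^]\<^bsub>GammaL4\<^esub> n =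
    (Emat a' b' (cyclic_trace (frob p l ^^ k) n c) (S (cyclic_trace (frob p l ^^ k) n c)),
     frob p l ^^ (k * n))"
  using Emat_semilinear_pow[of "frob p l ^^ k" S a b c n] frob_funpow_aut additive_axioms S_frob_funpow
  by (simp add: funpow_mult)

lemma twisted_pow_coprime:
  assumes "coprime k (p ^ e)"
  shows "\<exists>a' b'. twisted_elem a b c k [^]\<^bsub>GammaL4\<^esub> (p ^ e) =
    (Emat a' b' (field_trace c) (S (field_trace c)), id)"
proof -
  have "frob p l ^^ (k * p ^ e) = (id :: 'a \<Rightarrow> 'a)" by (rule frob_period_dvd) simp
  then show ?thesis
    using twisted_pow[of a b c k "p ^ e"] cyclic_trace_funpow_coprime[OF frob_period assms]
    by (simp only: field_trace_def)
qed

lemma twisted_pow_split: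
  assumes "x \<in> twisted"
  shows "x [^]\<^bsub>GammaL4\<^esub> (p ^ (i + j)) = (x [^]\<^bsub>GammaL4\<^esub> (p ^ i)) [^]\<^bsub>GammaL4\<^esub> (p ^ j)"
  using GL4.nat_pow_pow[of x] twisted_subset_carrier assms by (auto simp: power_add)

lemma twisted_pow_eq_one_of_dvd:
  assumes "p ^ e dvd k * p ^ i"
  shows "twisted_elem a b c k [^]\<^bsub>GammaL4\<^esub> (p ^ (i + 2)) = \<one>\<^bsub>GammaL4\<^esub>"
proof -
  have mem: "twisted_elem a b c k \<in> twisted" by (auto simp: twisted_def)
  obtain a' b' c' t' where "twisted_elem a b c k [^]\<^bsub>GammaL4\<^esub> (p ^ i) = (Emat a' b' c' t', id)"
    using twisted_pow[of a b c k "p ^ i"] frob_period_dvd[OF assms] by auto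
  then show ?thesis
    using twisted_pow_split[OF mem, of i 2] Emat_linear_pow_char_sq[OF char_field] by simp
qed

lemma twisted_pow_coprime_ne_one:
  assumes "coprime k (p ^ e)" "field_trace c \<noteq> 0"
  shows "twisted_elem a b c k [^]\<^bsub>GammaL4\<^esub> (p ^ e) \<noteq> \<one>\<^bsub>GammaL4\<^esub>"
  using twisted_pow_coprime[OF assms(1), of a b c] assms(2) by (auto simp: GammaL4_one Emat_eq_iff)

lemma twisted_pow_coprime_eq_one_iff:
  assumes "coprime k (p ^ e)" "odd p"
  shows "twisted_elem a b c k [^]\<^bsub>GammaL4\<^esub> (p ^ (e + 1)) = \<one>\<^bsub>GammaL4\<^esub> \<longleftrightarrow>
    p \<noteq> 3 \<or> S (field_trace c) = 0"
proof -
  have mem: "twisted_elem a b c k \<in> twisted" by (auto simp: twisted_def)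
  obtain a' b' where "twisted_elem a b c k [^]\<^bsub>GammaL4\<^esub> (p ^ e) =
      (Emat a' b' (field_trace c) (S (field_trace c)), id)"
    using twisted_pow_coprime[OF assms(1)] by blast
  then show ?thesis
    using twisted_pow_split[OF mem, of e 1] Emat_linear_pow_char_eq_one_iff[OF char_field assms(2)] zero
    by auto
qed

lemma twisted_pow_ne_one_imp:
  assumes "x \<in> twisted" "odd p" "x [^]\<^bsub>GammaL4\<^esub> (p ^ (e + 1)) \<noteq> \<one>\<^bsub>GammaL4\<^esub>"
  shows "p = 3 \<and> (\<exists>y\<in>subfld p l. S y \<noteq> 0)"
proof -
  obtain a b c k where x: "x = twisted_elem a b c k"
    using assms(1) by (auto simp: twisted_def)
  have "coprime k (p ^ e)"
  proof (rule ccontr)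
    assume "\<not> coprime k (p ^ e)"
    then have "p dvd k" "e \<noteq> 0"
      using prime_imp_coprime[OF prime_p, of k] by (auto simp: coprime_commute)
    then have "p ^ e dvd k * p ^ (e - 1)" by (cases e) auto
    then show False
      using assms(3) twisted_pow_eq_one_of_dvd[of k "e - 1" a b c] \<open>e \<noteq> 0\<close> by (simp add: x)
  qed
  then show ?thesis
    using assms(2,3) twisted_pow_coprime_eq_one_iff field_trace_in_subfld unfolding x by blast
qed

lemma generic_element_nonzero:
  assumes "\<mu> \<noteq> 0" "v \<noteq> 0" "v ^ p = v" "trace_hyperplane p (p ^ e * l) \<mu> v \<subseteq> generic_entries X"
    and "Modules.additive h" "h y \<noteq> (0 :: 'a)"
  obtains a b c k where "twisted_elem a b c k \<in> X" "coprime k (p ^ e)" "h c \<noteq> 0"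
proof -
  obtain c where "c \<in> trace_hyperplane p (p ^ e * l) \<mu> v" "h c \<noteq> 0"
    using additive_nonzero_on_trace_hyperplane[OF prime_p card_field assms(1-3,5,6)] .
  then have "c \<in> generic_entries X" using assms(4) by blast
  then obtain a b k where "twisted_elem a b c k \<in> X" "coprime k (p ^ e)"
    unfolding generic_entries_def by blast
  then show ?thesis using \<open>h c \<noteq> 0\<close> by (rule that)
qed

lemma group_exp_twisted:
  assumes "X \<subseteq> twisted"
    and generic: "\<mu> \<noteq> 0" "v \<noteq> 0" "v ^ p = v" "trace_hyperplane p (p ^ e * l) \<mu> v \<subseteq> generic_entries X"
  shows "group_exp (GammaL4\<lparr>carrier := X\<rparr>) \<in> {p ^ (e + 1), p ^ (e + 2)}"
    and "odd p \<Longrightarrow> group_exp (GammaL4\<lparr>carrier := X\<rparr>) = p ^ (e + 2) \<longleftrightarrow>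
      p = 3 \<and> (\<exists>y\<in>subfld p l. S y \<noteq> 0)"
proof -
  have carrier: "X \<subseteq> carrier GammaL4" using assms(1) twisted_subset_carrier by (rule order.trans)
  have bound: "\<forall>x\<in>X. x [^]\<^bsub>GammaL4\<^esub> (p ^ (e + 2)) = \<one>\<^bsub>GammaL4\<^esub>"
    using assms(1) twisted_pow_eq_one_of_dvd[of _ e] by (auto simp: twisted_def)
  have nontrivial: "\<exists>x\<in>X. x [^]\<^bsub>GammaL4\<^esub> (p ^ e) \<noteq> \<one>\<^bsub>GammaL4\<^esub>"
  proof -
    obtain z where "field_trace z \<noteq> 0" using field_trace_nonzero by blast
    then obtain a b c k where
      "twisted_elem a b c k \<in> X" "coprime k (p ^ e)" "field_trace c \<noteq> 0"
      by (rule generic_element_nonzero[OF generic additive_field_trace])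
    then show ?thesis using twisted_pow_coprime_ne_one by blast
  qed
  note dichotomy = GL4.group_exp_dichotomy[OF prime_p carrier bound nontrivial]
  show "group_exp (GammaL4\<lparr>carrier := X\<rparr>) \<in> {p ^ (e + 1), p ^ (e + 2)}"
    by (rule dichotomy(1))
  assume "odd p"
  have "\<exists>x\<in>X. x [^]\<^bsub>GammaL4\<^esub> (p ^ (e + 1)) \<noteq> \<one>\<^bsub>GammaL4\<^esub>"
    if "p = 3" "y \<in> subfld p l" "S y \<noteq> 0" for y
  proof -
    obtain z where "S (field_trace z) \<noteq> 0"
      using field_trace_onto_subfld[OF \<open>y \<in> subfld p l\<close>] \<open>S y \<noteq> 0\<close> by blast
    moreover have "Modules.additive (\<lambda>c. S (field_trace c))"
      by (simp add: Modules.additive_def add additive.add[OF additive_field_trace])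
    ultimately obtain a b c k where
      "twisted_elem a b c k \<in> X" "coprime k (p ^ e)" "S (field_trace c) \<noteq> 0"
      using generic_element_nonzero[OF generic, of "\<lambda>c. S (field_trace c)" z] by blast
    then show ?thesis using twisted_pow_coprime_eq_one_iff \<open>odd p\<close> \<open>p = 3\<close> by blast
  qed
  then show "group_exp (GammaL4\<lparr>carrier := X\<rparr>) = p ^ (e + 2) \<longleftrightarrow> p = 3 \<and> (\<exists>y\<in>subfld p l. S y \<noteq> 0)"
    unfolding dichotomy(2) using twisted_pow_ne_one_imp[OF _ \<open>odd p\<close>] assms(1) by blast
qed

lemma group_exp_Gset:
  fixes k :: "'a \<Rightarrow> 'a \<Rightarrow> 'a \<Rightarrow> nat"
  assumes "\<mu> \<noteq> 0" "v \<noteq> 0" "v ^ p = v"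
    and "\<And>c. c \<in> trace_hyperplane p (p ^ e * l) \<mu> v \<Longrightarrow> \<exists>a b. coprime (k a b c) (p ^ e)"
  shows "group_exp (GammaL4\<lparr>carrier := Gset (\<lambda>a b. S) (\<lambda>a b c. frob p l ^^ k a b c)\<rparr>)
      \<in> {p ^ (e + 1), p ^ (e + 2)}"
    and "odd p \<Longrightarrow> group_exp (GammaL4\<lparr>carrier := Gset (\<lambda>a b. S) (\<lambda>a b c. frob p l ^^ k a b c)\<rparr>) =
      p ^ (e + 2) \<longleftrightarrow> p = 3 \<and> (\<exists>y\<in>subfld p l. S y \<noteq> 0)"
proof -
  let ?X = "Gset (\<lambda>a b. S) (\<lambda>a b c. frob p l ^^ k a b c)"
  have twisted: "?X \<subseteq> twisted" by (auto simp: Gset_def gelt_def twisted_def)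
  have generic: "trace_hyperplane p (p ^ e * l) \<mu> v \<subseteq> generic_entries ?X"
  proof
    fix c
    assume "c \<in> trace_hyperplane p (p ^ e * l) \<mu> v"
    then obtain a b where "coprime (k a b c) (p ^ e)" using assms(4) by blast
    then show "c \<in> generic_entries ?X"
      unfolding Gset_def gelt_def generic_entries_def by blast
  qed
  note exps = group_exp_twisted[OF twisted assms(1-3) generic]
  show "group_exp (GammaL4\<lparr>carrier := ?X\<rparr>) \<in> {p ^ (e + 1), p ^ (e + 2)}"
    by (rule exps(1))
  assume "odd p"
  then show "group_exp (GammaL4\<lparr>carrier := ?X\<rparr>) = p ^ (e + 2) \<longleftrightarrow> p = 3 \<and> (\<exists>y\<in>subfld p l. S y \<noteq> 0)"
    by (rule exps(2))
qed

lemma generic_entries_generate: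
  assumes "\<mu> \<in> subfld p l" and t: "(Emat 0 0 t (S t), frob p l) \<in> Y"
    and kernel: "\<And>d. d \<in> trace_hyperplane p (p ^ e * l) \<mu> 0 \<Longrightarrow> \<exists>k. twisted_elem 0 0 d (p * k) \<in> Y"
  shows "trace_hyperplane p (p ^ e * l) \<mu> (tr p (p ^ e * l) (\<mu> * t))
    \<subseteq> generic_entries (generate GammaL4 Y)"
proof
  fix c
  assume "c \<in> trace_hyperplane p (p ^ e * l) \<mu> (tr p (p ^ e * l) (\<mu> * t))"
  then have c: "tr p (p ^ e * l) (\<mu> * c) = tr p (p ^ e * l) (\<mu> * t)" by (simp add: trace_hyperplane_def)
  have aut: "frob p l \<in> (field_auts :: ('a \<Rightarrow> 'a) set)" by (rule frob_field_auts[OF char_field])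
  then have "surj (frob p l :: 'a \<Rightarrow> 'a)" by (simp add: field_auts_def bij_is_surj)
  then obtain d where d: "frob p l d = c - t" by (metis surjD)
  have "frob p l (\<mu> * d) = \<mu> * c - \<mu> * t"
    using aut assms(1) d by (simp add: field_auts_def mem_subfld_iff right_diff_distrib)
  then have "tr p (p ^ e * l) (\<mu> * d) = tr p (p ^ e * l) (\<mu> * c - \<mu> * t)"
    using tr_frob[OF card_field] by metis
  then have "d \<in> trace_hyperplane p (p ^ e * l) \<mu> 0"
    using c by (simp add: trace_hyperplane_def additive.diff[OF additive_tr[OF char_field]])
  then obtain k where d_in_Y: "twisted_elem 0 0 d (p * k) \<in> Y" using kernel by blast
  have entries: "frob p l d + t = c" "frob p l (S d) + S t = S c"
    using d by (simp_all add: S_frob[symmetric] diff)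
  have "twisted_elem 0 0 d (p * k) \<otimes>\<^bsub>GammaL4\<^esub> (Emat 0 0 t (S t), frob p l) \<in> generate GammaL4 Y"
    by (intro generate.eng generate.incl d_in_Y t)
  then have "\<exists>a b. twisted_elem a b c (Suc (p * k)) \<in> generate GammaL4 Y"
    unfolding GammaL4_mult_Emat[OF aut] entries funpow.simps(2) by blast
  moreover have "coprime (Suc (p * k)) (p ^ e)"
    using coprime_Suc_left_nat[of "p * k"] unfolding coprime_mult_right_iff by simp
  ultimately show "c \<in> generic_entries (generate GammaL4 Y)"
    unfolding generic_entries_def by blast
qed

end

lemma twisted_group_lin_poly:
  assumes "prime p" "CARD('a::finite_field) = p ^ (p ^ e * l)" "\<forall>i<m. s i \<in> (subfld p l :: 'a set)"
  shows "twisted_group (lin_poly p m s) p e l"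
  using assms CHAR_eq_of_CARD[OF assms(1,2)]
  by (simp add: twisted_group_def twisted_group_axioms_def additive_lin_poly lin_poly_frob)

section \<open>The four constructions\<close>

lemma group_exp_A:
  fixes s :: "nat \<Rightarrow> 'a::finite_field"
  assumes "prime p" "CARD('a) = p ^ m"
  shows "group_exp (group_A p m s) \<in> {p, p ^ 2}"
    and "odd p \<Longrightarrow> group_exp (group_A p m s) = p ^ 2 \<longleftrightarrow> p = 3 \<and> (\<exists>x. lin_poly p m s x \<noteq> 0)"
proof -
  have subfld_UNIV: "subfld p m = (UNIV :: 'a set)"
    by (simp add: set_eq_iff mem_subfld_iff frob_CARD[OF assms(2)])
  interpret twisted_group "lin_poly p m s" p 0 m
    by (rule twisted_group_lin_poly) (simp_all add: assms subfld_UNIV)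
  note exps = group_exp_Gset[of 1 1 "\<lambda>a b c. 0", unfolded power_0 mult_1 add_0 subfld_UNIV]
  show "group_exp (group_A p m s) \<in> {p, p ^ 2}"
    using exps(1) by (simp add: group_A_def id_def)
  show "odd p \<Longrightarrow> group_exp (group_A p m s) = p ^ 2 \<longleftrightarrow> p = 3 \<and> (\<exists>x. lin_poly p m s x \<noteq> 0)"
    using exps(2) by (simp add: group_A_def id_def)
qed

lemma group_exp_B:
  fixes s :: "nat \<Rightarrow> 'a::finite_field"
  assumes "params_B p l s \<mu>\<^sub>C"
  shows "group_exp (group_B p l s \<mu>\<^sub>C) \<in> {p ^ 2, p ^ 3}"
    and "group_exp (group_B p l s \<mu>\<^sub>C) = p ^ 3 \<longleftrightarrow> p = 3 \<and> (\<exists>x\<in>subfld 3 l. lin_poly p (p * l) s x \<noteq> 0)"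
proof -
  interpret twisted_group "lin_poly p (p * l) s" p 1 l
    using assms by (intro twisted_group_lin_poly) (auto simp: params_B_def)
  have "odd p" "\<mu>\<^sub>C \<noteq> 0" using assms by (auto simp: params_B_def)
  let ?k = "\<lambda>a b c. rep (tr p (p * l) (\<mu>\<^sub>C * c))"
  have generic: "\<exists>a b :: 'a. coprime (?k a b c) (p ^ 1)" 
    if "c \<in> trace_hyperplane p (p ^ 1 * l) \<mu>\<^sub>C 1" for c
    using that coprime_rep[OF char_field, of 1] by (simp add: trace_hyperplane_def)
  note exps = group_exp_Gset[where k = ?k, OF \<open>\<mu>\<^sub>C \<noteq> 0\<close> one_neq_zero power_one generic]
  show "group_exp (group_B p l s \<mu>\<^sub>C) \<in> {p ^ 2, p ^ 3}"
    using exps(1) by (simp add: group_B_def numeral_eq_Suc)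
  show "group_exp (group_B p l s \<mu>\<^sub>C) = p ^ 3 \<longleftrightarrow> p = 3 \<and> (\<exists>x\<in>subfld 3 l. lin_poly p (p * l) s x \<noteq> 0)"
    using exps(2)[OF _ \<open>odd p\<close>] by (auto simp: group_B_def numeral_eq_Suc)
qed

lemma group_exp_C:
  fixes s :: "nat \<Rightarrow> 'a::finite_field"
  assumes "params_C p l s \<mu>\<^sub>B"
  shows "group_exp (group_C p l s \<mu>\<^sub>B) \<in> {p ^ 2, p ^ 3}"
    and "group_exp (group_C p l s \<mu>\<^sub>B) = p ^ 3 \<longleftrightarrow> p = 3 \<and> (\<exists>x\<in>subfld 3 l. lin_poly p (p * l) s x \<noteq> 0)"
proof -
  interpret twisted_group "lin_poly p (p * l) s" p 1 l
    using assms by (intro twisted_group_lin_poly) (auto simp: params_C_def)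
  have "odd p" "\<mu>\<^sub>B \<noteq> 0" and card: "CARD('a) = p ^ (p * l)"
    using assms by (auto simp: params_C_def)
  let ?z = "\<lambda>b c. Qform p (p * l) s \<mu>\<^sub>B c / 2 + tr p (p * l) (\<mu>\<^sub>B * b)"
  have prime_field: "?z b c ^ p = ?z b c" for b c
  proof -
    have "(2 :: 'a) ^ p = 2" using power_char_power_add[OF char_field, of 1 1 1] by simp
    then show ?thesis
      using power_char_power_add[OF char_field, of "Qform p (p * l) s \<mu>\<^sub>B c / 2" _ 1] \<open>odd p\<close>
      by (simp add: Qform_def power_divide tr_power_char[OF char_field card])
  qed
  have generic: "\<exists>a b :: 'a. coprime (rep (?z b c)) (p ^ 1)" for c
  proof -
    obtain b where "tr p (p * l) (\<mu>\<^sub>B * b) \<noteq> 0"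
      using tr_mult_nonzero[OF prime_p card \<open>\<mu>\<^sub>B \<noteq> 0\<close>] by blast
    then have "?z 0 c \<noteq> 0 \<or> ?z b c \<noteq> 0"
      using additive.zero[OF additive_tr[OF char_field]] by auto
    then obtain b' where nonzero: "?z b' c \<noteq> 0" by blast
    then show ?thesis using coprime_rep[OF char_field prime_field nonzero] by auto
  qed
  note exps = group_exp_Gset[where k = "\<lambda>a b c. rep (?z b c)",
      OF one_neq_zero one_neq_zero power_one generic]
  show "group_exp (group_C p l s \<mu>\<^sub>B) \<in> {p ^ 2, p ^ 3}"
    using exps(1) by (simp add: group_C_def numeral_eq_Suc)
  show "group_exp (group_C p l s \<mu>\<^sub>B) = p ^ 3 \<longleftrightarrow> p = 3 \<and> (\<exists>x\<in>subfld 3 l. lin_poly p (p * l) s x \<noteq> 0)"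
    using exps(2)[OF \<open>odd p\<close>] by (auto simp: group_C_def numeral_eq_Suc)
qed

lemma group_exp_D:
  fixes s :: "nat \<Rightarrow> 'a::finite_field"
  assumes "params_D l s u t\<^sub>C \<mu>\<^sub>B \<alpha> lam"
  shows "group_exp (group_D l s u t\<^sub>C \<mu>\<^sub>B \<alpha>) \<in> {3 ^ 3, 3 ^ 4}"
    and "group_exp (group_D l s u t\<^sub>C \<mu>\<^sub>B \<alpha>) = 3 ^ 4 \<longleftrightarrow> (\<exists>x\<in>subfld 3 l. lin_poly 3 (9 * l) s x \<noteq> 0)"
proof -
  let ?S = "lin_poly 3 (9 * l) s"
  let ?k = "\<lambda>b c. rep (Qform 3 (9 * l) s \<mu>\<^sub>B c / 2 + tr 3 (9 * l) (\<alpha> * c + \<mu>\<^sub>B * b))"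
  define \<mu> where "\<mu> = u - frob 3 l u"
  define Y :: "(('a^4^4) \<times> ('a \<Rightarrow> 'a)) set" where
    "Y = {(Emat a b c (?S c), frob 3 l ^^ (3 * ?k b c)) | a b c. tr 3 (9 * l) (\<mu> * c) = 0}
      \<union> {(Emat 0 0 t\<^sub>C (?S t\<^sub>C), frob 3 l)}"
  have card: "CARD('a) = 3 ^ (9 * l)" and \<mu>: "\<mu> \<in> subfld 3 l" "\<mu> \<noteq> 0"
    and trace_t\<^sub>C: "tr 3 (9 * l) (\<mu> * t\<^sub>C) \<noteq> 0" and "\<forall>i<9 * l. s i \<in> subfld 3 l"
    using assms by (auto simp: params_D_def Let_def \<mu>_def)
  then interpret twisted_group ?S 3 2 l
    by (intro twisted_group_lin_poly) simp_all
  have group_D: "group_D l s u t\<^sub>C \<mu>\<^sub>B \<alpha> = GammaL4\<lparr>carrier := generate GammaL4 Y\<rparr>"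
    by (simp add: group_D_def Let_def gelt_def Y_def \<mu>_def funpow_mult)
  have "twisted_elem a b c 1 \<in> twisted" for a b c
    unfolding twisted_def by blast
  then have "Y \<subseteq> twisted" by (auto simp: Y_def twisted_def)
  then have subset: "generate GammaL4 Y \<subseteq> twisted"
    by (rule GL4.generate_subgroup_incl[OF _ subgroup_twisted])
  have generic: "trace_hyperplane 3 (3\<^sup>2 * l) \<mu> (tr 3 (3\<^sup>2 * l) (\<mu> * t\<^sub>C))
      \<subseteq> generic_entries (generate GammaL4 Y)"
    by (rule generic_entries_generate[OF \<mu>(1)]) (auto simp: Y_def trace_hyperplane_def)
  note exps = group_exp_twisted[OF subset \<mu>(2) _ _ generic]
  show "group_exp (group_D l s u t\<^sub>C \<mu>\<^sub>B \<alpha>) \<in> {3 ^ 3, 3 ^ 4}"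
    using exps(1) trace_t\<^sub>C tr_power_char[OF char_field card] by (simp add: group_D)
  show "group_exp (group_D l s u t\<^sub>C \<mu>\<^sub>B \<alpha>) = 3 ^ 4 \<longleftrightarrow> (\<exists>x\<in>subfld 3 l. ?S x \<noteq> 0)"
    using exps(2) trace_t\<^sub>C tr_power_char[OF char_field card] by (simp add: group_D)
qed

theorem theorem8p3:
  shows
    "(\<forall>p m. \<forall>s :: nat \<Rightarrow> 'a::finite_field. prime p \<and> CARD('a) = p ^ m \<longrightarrow>
        group_exp (group_A p m s) \<in> {p, p ^ 2} \<and>
        (odd p \<longrightarrow>
          (group_exp (group_A p m s) = p ^ 2 \<longleftrightarrow> p = 3 \<and> (\<exists>x. lin_poly p m s x \<noteq> 0))))
   \<and> (\<forall>p l. \<forall>s :: nat \<Rightarrow> 'a. \<forall>\<mu>\<^sub>C. params_B p l s \<mu>\<^sub>C \<longrightarrow>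
        group_exp (group_B p l s \<mu>\<^sub>C) \<in> {p ^ 2, p ^ 3} \<and>
        (group_exp (group_B p l s \<mu>\<^sub>C) = p ^ 3 \<longleftrightarrow>
          p = 3 \<and> (\<exists>x\<in>subfld 3 l. lin_poly p (p * l) s x \<noteq> 0)))
   \<and> (\<forall>p l. \<forall>s :: nat \<Rightarrow> 'a. \<forall>\<mu>\<^sub>B. params_C p l s \<mu>\<^sub>B \<longrightarrow>
        group_exp (group_C p l s \<mu>\<^sub>B) \<in> {p ^ 2, p ^ 3} \<and>
        (group_exp (group_C p l s \<mu>\<^sub>B) = p ^ 3 \<longleftrightarrow>
          p = 3 \<and> (\<exists>x\<in>subfld 3 l. lin_poly p (p * l) s x \<noteq> 0)))
   \<and> (\<forall>l. \<forall>s :: nat \<Rightarrow> 'a. \<forall>u t\<^sub>C \<mu>\<^sub>B \<alpha> lam. params_D l s u t\<^sub>C \<mu>\<^sub>B \<alpha> lam \<longrightarrow>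
        group_exp (group_D l s u t\<^sub>C \<mu>\<^sub>B \<alpha>) \<in> {3 ^ 3, 3 ^ 4} \<and>
        (group_exp (group_D l s u t\<^sub>C \<mu>\<^sub>B \<alpha>) = 3 ^ 4 \<longleftrightarrow>
          (\<exists>x\<in>subfld 3 l. lin_poly 3 (9 * l) s x \<noteq> 0)))"
  by (intro conjI allI impI; (elim conjE)?;
      rule group_exp_A group_exp_B group_exp_C group_exp_D; assumption)

end
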